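(* Let $m\geq 3$ be an integer. For $3\leq \ell\leq 2m-3$, let $\zeta_{\ell,m}\in S_{2m-3}$ be the permutation obtained from the identity permutation $123\cdots(2m-3)$ by swapping the entries $1$ and $2$ and then moving the entry $\ell$ to the beginning, i.e. $\zeta_{\ell,m}=\ell\,2\,1\,3\,4\cdots(\ell-1)(\ell+1)\cdots(2m-3)$. A permutation $\pi\in S_{2m-3}$ lies in $s^{m-3}(S_{2m-3})$ if and only if one of the following holds: (i) $\operatorname{tl}(\pi)\geq m-3$ and every descent top of $\pi$ is a left-to-right maximum of $\pi$; or (ii) $\pi=\zeta_{\ell,m}$ for some $\ell\in\{3,\ldots,m\}$. Consequently, $|s^{m-3}(S_{2m-3})|=B_m+m-2$, where $B_m$ is the $m$-th Bell number.
   Context: A permutation is an ordering of a finite set of positive integers, written in one-line notation; $S_n$ is the set of permutations of $[n]=\{1,\ldots,n\}$. West's stack-sorting map $s$ is defined recursively: $s$ sends the empty permutation to itself, and for a nonempty permutation $\pi=LmR$ with $m$ its largest entry, $s(\pi)=s(L)\,s(R)\,m$. $s^t$ denotes the $t$-fold iterate. For $\pi=\pi_1\cdots\pi_n$, a descent top is an entry $\pi_i$ with $\pi_i>\pi_{i+1}$. A left-to-right maximum is an entry $\pi_j$ with $\pi_j>\pi_\ell$ for all $\ell<j$. The tail length $\operatorname{tl}(\pi)$ of $\pi\in S_n$ is the largest $\ell\in\{0,\ldots,n\}$ such that $\pi_i=i$ for all $i\in\{n-\ell+1,\ldots,n\}$. The Bell number $B_m$ is the number of set partitions of $[m]$. 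*)

theory Defs
  imports Main "HOL-Library.Disjoint_Sets" "HOL-Combinatorics.Multiset_Permutations"
begin

text \<open>Permutations are distinct lists of naturals in one-line notation. Lists are indexed from 0,
  so the entry \<open>\<pi>\<^sub>i\<close> is \<open>p ! (i - 1)\<close>.\<close>

abbreviation Sn :: "nat \<Rightarrow> nat list set" where
  "Sn n \<equiv> permutations_of_set {1..n}"

function stack_sort :: "nat list \<Rightarrow> nat list" where
  "stack_sort xs =
     (if xs = [] then []
      else let m = Max (set xs);
               L = takeWhile (\<lambda>x. x \<noteq> m) xs;
               R = tl (dropWhile (\<lambda>x. x \<noteq> m) xs)
           in stack_sort L @ stack_sort R @ [m])"
  by pat_completeness auto
termination
proof (relation "Wellfounded.measure length")
  fix xs :: "nat list" and m L
  assume "xs \<noteq> []" "m = Max (set xs)" "L = takeWhile (\<lambda>x. x \<noteq> m) xs"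
  moreover from this have "m \<in> set xs" by simp
  ultimately have "length L \<noteq> length xs"
    by (metis (full_types) set_takeWhileD takeWhile_eq_take take_all order_refl)
  moreover have "length L \<le> length xs"
    using \<open>L = _\<close> by (simp add: length_takeWhile_le)
  ultimately show "(L, xs) \<in> Wellfounded.measure length" by simp
next
  fix xs :: "nat list" and m L R
  assume "xs \<noteq> []" "R = tl (dropWhile (\<lambda>x. x \<noteq> m) xs)"
  moreover have "length (dropWhile (\<lambda>x. x \<noteq> m) xs) \<le> length xs"
    by (rule length_dropWhile_le)
  moreover have "length xs > 0" using \<open>xs \<noteq> []\<close> by simp
  ultimately have "length R < length xs" by (simp only: length_tl)
  then show "(R, xs) \<in> Wellfounded.measure length" by simp
qed simp

declare stack_sort.simps [simp del]

lemma stack_sort_Nil: "stack_sort [] = []"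
  by (simp add: stack_sort.simps)

lemma stack_sort_LmR:
  assumes "distinct (L @ m # R)" "\<forall>x \<in> set L \<union> set R. x < m"
  shows "stack_sort (L @ m # R) = stack_sort L @ stack_sort R @ [m]"
proof -
  have "Max (set (L @ m # R)) = m"
    using assms by (intro Max_eqI) (auto simp: less_imp_le)
  moreover have "takeWhile (\<lambda>x. x \<noteq> m) (L @ m # R) = L"
    using assms by (subst takeWhile_append2) auto
  moreover have "dropWhile (\<lambda>x. x \<noteq> m) (L @ m # R) = m # R"
    using assms by (subst dropWhile_append2) auto
  ultimately show ?thesis
    by (subst stack_sort.simps) (simp add: Let_def)
qed

definition descent_top :: "nat list \<Rightarrow> nat \<Rightarrow> bool" where
  "descent_top p x \<longleftrightarrow> (\<exists>i. Suc i < length p \<and> x = p ! i \<and> p ! i > p ! Suc i)"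

definition lr_max :: "nat list \<Rightarrow> nat \<Rightarrow> bool" where
  "lr_max p x \<longleftrightarrow> (\<exists>j < length p. x = p ! j \<and> (\<forall>k < j. p ! k < p ! j))"

definition tail_length :: "nat list \<Rightarrow> nat" where
  "tail_length p =
     Max {l. l \<le> length p \<and> (\<forall>i \<in> {length p - l + 1..length p}. p ! (i - 1) = i)}"

definition bell :: "nat \<Rightarrow> nat" where
  "bell m = card {P. partition_on {1..m} P}"

text \<open>The permutation \<open>l 2 1 3 4 \<dots> (l-1) (l+1) \<dots> (2m-3)\<close>, meant for \<open>3 \<le> l \<le> 2m-3\<close>.\<close>
definition zeta :: "nat \<Rightarrow> nat \<Rightarrow> nat list" where
  "zeta l m = l # 2 # 1 # [3..<l] @ [l + 1..<2 * m - 2]"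

lemma zeta_in_Sn:
  assumes "3 \<le> l" "l \<le> 2 * m - 3"
  shows "zeta l m \<in> Sn (2 * m - 3)"
proof
  show "set (zeta l m) = {1..2 * m - 3}"
    using assms by (auto simp: zeta_def)
  show "distinct (zeta l m)"
    using assms by (auto simp: zeta_def)
qed

end

theory Submission
  imports Defs
begin

text \<open>
  Write \<open>t = m - 3\<close>, so that the permutations have length \<open>2t + 3\<close>. If \<open>y < x\<close>, then \<open>x\<close> precedes
  \<open>y\<close> in \<open>s(\<pi>)\<close> iff in \<open>\<pi>\<close> some \<open>z > x\<close> lies between \<open>x\<close> and \<open>y\<close>. Suppose \<open>c a\<close> is a descent of
  \<open>s\<^sup>t(\<sigma>)\<close> with some \<open>b > c\<close> to its left. In each earlier iterate let \<open>D\<close> and \<open>M\<close> be the largest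
  entries between \<open>b\<close> and \<open>c\<close> and between \<open>c\<close> and \<open>a\<close>. One always has \<open>M < D\<close>, since otherwise
  \<open>c\<close> and \<open>a\<close> would never become adjacent, and then both \<open>M\<close> and \<open>D\<close> jump to the right of \<open>a\<close>
  in a single step. So at least \<open>2t\<close> entries above \<open>c\<close>, all different from \<open>b\<close>, end up to the right
  of \<open>a\<close>; with only \<open>2t + 3\<close> entries available this forces \<open>c = 2\<close>, \<open>a = 1\<close> and
  \<open>s\<^sup>t(\<sigma>) = \<zeta>\<^sub>b\<close>.

  Conversely, a permutation whose descent tops are left-to-right maxima, cut before each of these
  maxima, is \<open>d\<^sub>1 w\<^sub>1 \<dots> d\<^sub>k w\<^sub>k\<close> with increasing \<open>w\<^sub>i\<close>. If it ends with its largest entry, so that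
  \<open>w\<^sub>k\<close> is empty, it is the image of \<open>d\<^sub>1 d\<^sub>2 w\<^sub>1 \<dots> d\<^sub>k w\<^sub>k\<^sub>-\<^sub>1\<close>, which has the same shape, and
  this can be iterated along the tail. The blocks \<open>d\<^sub>i w\<^sub>i\<close> form an arbitrary set partition, whence
  the Bell number.
\<close>

section \<open>Stack sorting along the maximum, and the fixed tail\<close>

text \<open>Splitting at the maximum follows the recursion of \<open>stack_sort\<close>, so
  \<open>stack_sort_LmR\<close> applies directly in the step case.\<close>

lemma distinct_max_induct [consumes 1, case_names Nil max]:
  fixes xs :: "nat list"
  assumes "distinct xs" "P []"
    and "\<And>L m R. \<lbrakk>distinct (L @ m # R); \<forall>x \<in> set L \<union> set R. x < m; P L; P R\<rbrakk> \<Longrightarrow> P (L @ m # R)"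
  shows "P xs"
  using assms(1)
proof (induction xs rule: length_induct)
  case (1 xs)
  show ?case
  proof (cases "xs = []")
    case False
    then have "Max (set xs) \<in> set xs" by simp
    then obtain L R where xs: "xs = L @ Max (set xs) # R"
      by (meson split_list)
    define m where "m = Max (set xs)"
    have eq: "xs = L @ m # R" using xs m_def by simp
    have d: "distinct (L @ m # R)" using "1.prems" eq by simp
    have le: "\<forall>x \<in> set xs. x \<le> m" by (simp add: m_def)
    have "\<forall>x \<in> set L \<union> set R. x < m"
    proof
      fix x assume x: "x \<in> set L \<union> set R"
      then have "x \<in> set xs" by (subst eq) auto
      moreover have "x \<noteq> m" using d x by auto
      ultimately show "x < m" using le by (simp add: order_less_le)
    qed
    moreover have "length L < length xs" "length R < length xs" by (simp_all add: eq)
    ultimately have "P (L @ m # R)"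
      using d "1.IH" by (intro assms(3)) auto
    then show ?thesis using eq by simp
  qed (simp add: assms(2))
qed

lemma stack_sort_set_distinct:
  assumes "distinct xs"
  shows "set (stack_sort xs) = set xs \<and> distinct (stack_sort xs)"
  using assms
proof (induction xs rule: distinct_max_induct)
  case (max L m R)
  then show ?case
    using stack_sort_LmR[OF max.hyps(1,2)] by auto
qed (simp add: stack_sort_Nil)

lemma set_stack_sort: "distinct xs \<Longrightarrow> set (stack_sort xs) = set xs"
  and distinct_stack_sort: "distinct xs \<Longrightarrow> distinct (stack_sort xs)"
  by (simp_all add: stack_sort_set_distinct)

text \<open>The last entry of \<open>B\<close> is the overall maximum with nothing to its right, so
  it stays last; peel \<open>B\<close> off from the right.\<close>

lemma stack_sort_append_increasing:
  assumes "distinct A" "sorted_wrt (<) B" "\<forall>x \<in> set A. \<forall>y \<in> set B. x < y"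
  shows "stack_sort (A @ B) = stack_sort A @ B"
  using assms(2,3)
proof (induction B rule: rev_induct)
  case (snoc m B)
  have "distinct B" using snoc.prems(1)
    by (simp add: sorted_wrt_append strict_sorted_iff)
  then have "distinct ((A @ B) @ m # [])" using assms(1) snoc.prems
    by (auto simp: sorted_wrt_append)
  moreover have "\<forall>x \<in> set (A @ B) \<union> set []. x < m" using snoc.prems
    by (auto simp: sorted_wrt_append)
  ultimately have "stack_sort ((A @ B) @ m # []) = stack_sort (A @ B) @ stack_sort [] @ [m]"
    by (rule stack_sort_LmR)
  then show ?case using snoc by (auto simp: stack_sort_Nil sorted_wrt_append)
qed simp

lemma stack_sort_increasing: "sorted_wrt (<) B \<Longrightarrow> stack_sort B = B"
  using stack_sort_append_increasing[of "[]" B] by (simp add: stack_sort_Nil)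

text \<open>Each pass moves the maximum of the remaining prefix to the end of that prefix and leaves
  the increasing tail alone.\<close>

lemma stack_sort_funpow_tail:
  assumes "p \<in> Sn n" "k \<le> n"
  shows "\<exists>q \<in> Sn (n - k). (stack_sort ^^ k) p = q @ [n - k + 1..<n + 1]"
  using assms(2)
proof (induction k)
  case (Suc k)
  then obtain q where q: "q \<in> Sn (n - k)" and eq: "(stack_sort ^^ k) p = q @ [n - k + 1..<n + 1]"
    by auto
  have qs: "set q = {1..n - k}" "distinct q" using q by (auto simp: permutations_of_set_def)
  have "n - k \<in> set q" using qs Suc.prems by auto
  then obtain L R where LR: "q = L @ (n - k) # R" by (meson split_list)
  have dist: "distinct (L @ (n - k) # R)" using qs LR by simp
  have lt: "\<forall>x \<in> set L \<union> set R. x < n - k"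
  proof
    fix x assume x: "x \<in> set L \<union> set R"
    then have "x \<in> set q" by (auto simp: LR)
    then have "x \<le> n - k" using qs by simp
    moreover have "x \<noteq> n - k" using x dist by auto
    ultimately show "x < n - k" by simp
  qed
  have "stack_sort (q @ [n - k + 1..<n + 1]) = stack_sort q @ [n - k + 1..<n + 1]"
    using qs by (intro stack_sort_append_increasing) (auto simp del: upt_Suc)
  also have "stack_sort q = (stack_sort L @ stack_sort R) @ [n - k]"
    using stack_sort_LmR[OF dist lt] LR by simp
  finally have 1: "(stack_sort ^^ Suc k) p = (stack_sort L @ stack_sort R) @ [n - Suc k + 1..<n + 1]"
    using eq Suc.prems by (simp add: upt_conv_Cons Suc_diff_Suc del: upt_Suc)
  have "set L \<union> set R = {1..n - k} - {n - k}"
    using qs dist LR by auto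
  also have "\<dots> = {1..n - Suc k}" by auto
  finally have "stack_sort L @ stack_sort R \<in> Sn (n - Suc k)"
    using dist by (auto simp: permutations_of_set_def set_stack_sort distinct_stack_sort)
  then show ?case using 1 by blast
qed (use assms in auto)

text \<open>The set under \<open>Max\<close> in \<open>tail_length\<close> is closed downwards, so a
  lower bound on the tail length is membership in it. This becomes a suffix equation, the form in
  which iterates of \<open>stack_sort\<close> are described.\<close>

lemma tail_length_ge_iff:
  assumes "p \<in> Sn n" "k \<le> n"
  shows "k \<le> tail_length p \<longleftrightarrow> (\<exists>q \<in> Sn (n - k). p = q @ [n - k + 1..<n + 1])"
proof -
  have p: "set p = {1..n}" "distinct p" using assms by (auto simp: permutations_of_set_def)
  then have len: "length p = n" using distinct_card[of p] by simp
  define S where "S = {l. l \<le> length p \<and> (\<forall>i \<in> {length p - l + 1..length p}. p ! (i - 1) = i)}"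
  have S: "finite S" "0 \<in> S" by (auto simp: S_def)
  have "k \<le> tail_length p \<longleftrightarrow> k \<in> S"
  proof
    assume "k \<le> tail_length p"
    moreover have "Max S \<in> S" using S by (intro Max_in) auto
    moreover have "tail_length p = Max S" by (simp only: tail_length_def S_def)
    ultimately obtain l where "k \<le> l" "l \<in> S" by metis
    then have "l \<le> length p" "\<forall>i \<in> {length p - l + 1..length p}. p ! (i - 1) = i"
      unfolding S_def by blast+
    moreover have "{length p - k + 1..length p} \<subseteq> {length p - l + 1..length p}"
      using \<open>k \<le> l\<close> by auto
    ultimately show "k \<in> S" using \<open>k \<le> l\<close> unfolding S_def mem_Collect_eq
      by (meson le_trans subsetD)
  next
    assume "k \<in> S"
    then show "k \<le> tail_length p" using S by (simp only: tail_length_def S_def[symmetric] Max_ge)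
  qed
  also have "k \<in> S \<longleftrightarrow> drop (n - k) p = [n - k + 1..<n + 1]"
  proof
    assume k: "k \<in> S"
    show "drop (n - k) p = [n - k + 1..<n + 1]"
    proof (rule nth_equalityI)
      fix i assume "i < length (drop (n - k) p)"
      then have i: "i < k" using len assms by simp
      then have "n - k + i + 1 \<in> {length p - k + 1..length p}" using len assms by auto
      then have "p ! (n - k + i + 1 - 1) = n - k + i + 1" using k unfolding S_def by blast
      then show "drop (n - k) p ! i = [n - k + 1..<n + 1] ! i"
        using i len assms by (simp del: upt_Suc)
    qed (use len assms in \<open>simp del: upt_Suc\<close>)
  next
    assume d: "drop (n - k) p = [n - k + 1..<n + 1]"
    have "p ! (i - 1) = i" if "i \<in> {length p - k + 1..length p}" for i
    proof -
      have "drop (n - k) p ! (i - 1 - (n - k)) = p ! (i - 1)"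
        using that len assms by (subst nth_drop) auto
      moreover have "[n - k + 1..<n + 1] ! (i - 1 - (n - k)) = i"
        using that len assms by (subst nth_upt) auto
      ultimately show ?thesis by (simp only: d)
    qed
    then show "k \<in> S" using len assms by (auto simp: S_def)
  qed
  also have "\<dots> \<longleftrightarrow> (\<exists>q \<in> Sn (n - k). p = q @ [n - k + 1..<n + 1])"
  proof
    assume d: "drop (n - k) p = [n - k + 1..<n + 1]"
    have eq: "p = take (n - k) p @ [n - k + 1..<n + 1]" using d append_take_drop_id by metis
    have "set (take (n - k) p) \<inter> {n - k + 1..n} = {}"
    proof -
      have "distinct (take (n - k) p @ [n - k + 1..<n + 1])" using p eq by simp
      then show ?thesis by (auto simp del: upt_Suc)
    qed
    moreover have "set (take (n - k) p) \<union> {n - k + 1..n} = {1..n}"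
    proof -
      have "set (take (n - k) p @ [n - k + 1..<n + 1]) = {1..n}" using p eq by simp
      then show ?thesis by (simp add: atLeastLessThanSuc_atLeastAtMost del: upt_Suc)
    qed
    ultimately have "set (take (n - k) p) = {1..n} - {n - k + 1..n}" by blast
    also have "\<dots> = {1..n - k}" by auto
    finally have "take (n - k) p \<in> Sn (n - k)" using p by (simp add: permutations_of_set_def)
    then show "\<exists>q \<in> Sn (n - k). p = q @ [n - k + 1..<n + 1]" using eq by blast
  next
    assume "\<exists>q \<in> Sn (n - k). p = q @ [n - k + 1..<n + 1]"
    then obtain q where "q \<in> Sn (n - k)" "p = q @ [n - k + 1..<n + 1]" by blast
    moreover from this have "length q = n - k"
      using length_finite_permutations_of_set by fastforce
    ultimately show "drop (n - k) p = [n - k + 1..<n + 1]" by simp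
  qed
  finally show ?thesis .
qed

text \<open>Permutations all of whose descent tops are left-to-right maxima (see \<open>good_iff_descent_tops\<close>);
  \<open>M # w\<close> is the last of the blocks beginning at a left-to-right maximum.\<close>
inductive good :: "nat list \<Rightarrow> bool" where
  Nil: "good []"
| block: "\<lbrakk>good q; sorted_wrt (<) w; set q \<inter> set w = {}; \<forall>x \<in> set q \<union> set w. x < M\<rbrakk>
    \<Longrightarrow> good (q @ M # w)"

lemma good_distinct: "good p \<Longrightarrow> distinct p"
  by (induction rule: good.induct) (auto simp: strict_sorted_iff)

lemma good_append_increasing:
  assumes "good q" "sorted_wrt (<) B" "\<forall>x \<in> set q. \<forall>y \<in> set B. x < y"
  shows "good (q @ B)"
  using assms(2,3)
proof (induction B rule: rev_induct)
  case (snoc m B)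
  then have "good ((q @ B) @ m # [])"
    by (intro good.block) (auto simp: sorted_wrt_append)
  then show ?case by simp
qed (simp add: assms(1))

text \<open>For \<open>p = q @ M # w\<close>, take a preimage \<open>r\<close> of
  \<open>q @ [M]\<close> by induction. Then \<open>r @ N # w\<close> is sent to
  \<open>q @ [M] @ w @ [N]\<close>, and \<open>N # w\<close> is its last block.\<close>

lemma good_stack_sort_preimage:
  assumes "good p" "\<forall>x \<in> set p. x < N"
  shows "\<exists>r. good r \<and> set r = insert N (set p) \<and> stack_sort r = p @ [N]"
  using assms
proof (induction arbitrary: N rule: good.induct)
  case Nil
  have "good ([] @ N # [])" by (rule good.block) (auto intro: good.Nil)
  moreover have "stack_sort [N] = [N]" by (simp add: stack_sort_increasing)
  ultimately show ?case by (intro exI[of _ "[N]"]) auto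
next
  case (block q w M)
  have "\<forall>x \<in> set q. x < M" using block.hyps(4) by blast
  from block.IH[OF this] obtain r
    where r: "good r" "set r = insert M (set q)" "stack_sort r = q @ [M]" by blast
  have disj: "set r \<inter> set w = {}" using r block.hyps by auto
  have lt: "\<forall>x \<in> set r \<union> set w. x < N" using r block.prems by auto
  have g: "good (r @ N # w)" using r(1) block.hyps(2) disj lt by (rule good.block)
  have "stack_sort (r @ N # w) = stack_sort r @ stack_sort w @ [N]"
    using good_distinct[OF g] lt by (rule stack_sort_LmR)
  also have "stack_sort w = w" using block.hyps(2) by (rule stack_sort_increasing)
  finally show ?case using g r by (intro exI[of _ "r @ N # w"]) auto
qed

text \<open>The preimage of \<open>q @ [m + 1]\<close> is again \<open>good\<close>, now on one more
  value, so each step back absorbs one entry of the tail.\<close>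

lemma good_tail_in_image:
  assumes "good q" "q \<in> Sn m"
  shows "q @ [m + 1..<m + k + 1] \<in> (stack_sort ^^ k) ` Sn (m + k)"
  using assms
proof (induction k arbitrary: q m)
  case (Suc k)
  have sq: "set q = {1..m}" "distinct q" using Suc.prems by (auto simp: permutations_of_set_def)
  then obtain r where r: "good r" "set r = insert (m + 1) (set q)" "stack_sort r = q @ [m + 1]"
    using good_stack_sort_preimage[OF Suc.prems(1), of "m + 1"] by fastforce
  have sr: "set r = {1..m + 1}" using r sq by auto
  then have "r \<in> Sn (m + 1)" using r good_distinct by (simp add: permutations_of_set_def)
  then have "r @ [m + 1 + 1..<m + 1 + k + 1] \<in> (stack_sort ^^ k) ` Sn (m + 1 + k)"
    using Suc.IH r by blast
  then obtain z where z: "z \<in> Sn (m + Suc k)"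
    "(stack_sort ^^ k) z = r @ [m + 1 + 1..<m + 1 + k + 1]" by auto
  have "stack_sort (r @ [m + 1 + 1..<m + 1 + k + 1]) = stack_sort r @ [m + 1 + 1..<m + 1 + k + 1]"
    using sr r(1) good_distinct[of r] by (intro stack_sort_append_increasing) (auto simp del: upt_Suc)
  then have "(stack_sort ^^ Suc k) z = q @ [m + 1..<m + Suc k + 1]"
    using z r by (simp add: upt_conv_Cons del: upt_Suc)
  then show ?case using z by (metis imageI)
qed simp

subsection \<open>Evolution of inversions\<close>

primrec before :: "'a list \<Rightarrow> 'a \<Rightarrow> 'a \<Rightarrow> bool" where
  "before [] x y \<longleftrightarrow> False"
| "before (z # zs) x y \<longleftrightarrow> x = z \<and> y \<in> set zs \<or> before zs x y"

lemma before_append: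
  "before (xs @ ys) x y \<longleftrightarrow> before xs x y \<or> before ys x y \<or> x \<in> set xs \<and> y \<in> set ys"
  by (induction xs) auto

lemma before_in_set: "before xs x y \<Longrightarrow> x \<in> set xs \<and> y \<in> set xs"
  by (induction xs) auto

lemma before_total: "x \<in> set xs \<Longrightarrow> y \<in> set xs \<Longrightarrow> x \<noteq> y \<Longrightarrow> before xs x y \<or> before xs y x"
  by (induction xs) auto

lemma before_asym: "distinct xs \<Longrightarrow> before xs x y \<Longrightarrow> \<not> before xs y x"
  by (induction xs) (auto dest: before_in_set)

lemma before_irrefl: "distinct xs \<Longrightarrow> \<not> before xs x x"
  using before_asym by metis

lemma before_trans: "before xs x y \<Longrightarrow> before xs y z \<Longrightarrow> distinct xs \<Longrightarrow> before xs x z"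
  by (induction xs) (auto dest: before_in_set)

lemma sorted_wrt_before: "(\<And>x y. before xs x y \<Longrightarrow> x < y) \<Longrightarrow> sorted_wrt (<) xs"
  by (induction xs) auto

text \<open>The pass places \<open>L\<close> before \<open>R\<close> and moves \<open>m\<close> to
  the end. If \<open>x\<close> is in \<open>L\<close> and \<open>y\<close> in \<open>R\<close>, then
  \<open>z = m\<close> is the witness; otherwise the claim reduces to \<open>L\<close> or to
  \<open>R\<close>, or both sides fail.\<close>

lemma before_stack_sort_iff:
  assumes "distinct xs" "y < x"
  shows "before (stack_sort xs) x y \<longleftrightarrow> (\<exists>z > x. before xs x z \<and> before xs z y)"
  using assms(1)
proof (induction xs rule: distinct_max_induct)
  case (max L m R)
  have eq: "stack_sort (L @ m # R) = stack_sort L @ stack_sort R @ [m]"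
    using max.hyps by (rule stack_sort_LmR)
  have sets: "set (stack_sort L) = set L" "set (stack_sort R) = set R"
    using max.hyps by (auto simp: set_stack_sort)
  have L: "before L u v \<Longrightarrow> u \<in> set L \<and> v \<in> set L" for u v by (rule before_in_set)
  have R: "before R u v \<Longrightarrow> u \<in> set R \<and> v \<in> set R" for u v by (rule before_in_set)
  have disj: "u \<in> set L \<Longrightarrow> u \<notin> set R" "u \<in> set L \<Longrightarrow> u < m" "u \<in> set R \<Longrightarrow> u < m" for u
    using max.hyps by auto
  have "before (stack_sort (L @ m # R)) x y \<longleftrightarrow>
      (\<exists>z>x. before L x z \<and> before L z y) \<or> (\<exists>z>x. before R x z \<and> before R z y)
      \<or> x \<in> set L \<and> y \<in> set R"
    using assms(2) disj[of x] disj[of y] max.IH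
    by (auto simp: eq before_append sets)
  also have "\<dots> \<longleftrightarrow> (\<exists>z>x. before (L @ m # R) x z \<and> before (L @ m # R) z y)"
  proof
    assume "\<exists>z>x. before (L @ m # R) x z \<and> before (L @ m # R) z y"
    then obtain z where z: "z > x" "before (L @ m # R) x z" "before (L @ m # R) z y" by blast
    have "x \<noteq> m" using z disj before_in_set[OF z(2)] by force
    moreover have "y \<noteq> m" using assms z disj before_in_set[OF z(2)] by force
    ultimately show "(\<exists>z>x. before L x z \<and> before L z y) \<or> (\<exists>z>x. before R x z \<and> before R z y)
        \<or> x \<in> set L \<and> y \<in> set R"
      using z disj(2,3) disj(1)[of z] L[of z y] R[of x z]
      by (auto simp: before_append dest: L R dest: disj(1))
  qed (auto simp: before_append disj intro: exI[of _ m])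
  finally show ?case .
qed (simp add: stack_sort_Nil)

lemma before_stack_sortD:
  "distinct xs \<Longrightarrow> y < x \<Longrightarrow> before (stack_sort xs) x y \<Longrightarrow> before xs x y"
  using before_stack_sort_iff before_trans by metis

lemma distinct_stack_sort_funpow: "distinct xs \<Longrightarrow> distinct ((stack_sort ^^ k) xs)"
  by (induction k) (auto intro: distinct_stack_sort)

lemma set_stack_sort_funpow: "distinct xs \<Longrightarrow> set ((stack_sort ^^ k) xs) = set xs"
  by (induction k) (auto simp: set_stack_sort distinct_stack_sort_funpow)

lemma before_stack_sort_funpowD:
  "distinct xs \<Longrightarrow> y < x \<Longrightarrow> before ((stack_sort ^^ k) xs) x y \<Longrightarrow> before xs x y"
  by (induction k) (auto dest: before_stack_sortD distinct_stack_sort_funpow)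

text \<open>This is \<open>M < D\<close> from the outline, written without maxima so that it also
  covers the case of no entry between \<open>c\<close> and \<open>a\<close>.\<close>

definition overtop :: "nat list \<Rightarrow> nat \<Rightarrow> nat \<Rightarrow> nat \<Rightarrow> bool" where
  "overtop xs b c a \<longleftrightarrow> (\<exists>d. before xs b d \<and> before xs d c \<and>
     (\<forall>x. before xs c x \<longrightarrow> before xs x a \<longrightarrow> x < d))"

text \<open>Let \<open>d\<close> be the largest entry between \<open>b\<close> and \<open>c\<close>. If some entry between
  \<open>c\<close> and \<open>a\<close> exceeds \<open>d\<close>, then \<open>d\<close> itself lands between \<open>c\<close> and \<open>a\<close>, while all entries
  above \<open>b\<close> that are between \<open>b\<close> and \<open>c\<close> afterwards are smaller than \<open>d\<close>; so the situation persists,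
  and \<open>c\<close> and \<open>a\<close> never become adjacent.\<close>
lemma overtop_step:
  fixes xs :: "nat list"
  defines "ys \<equiv> stack_sort xs"
  assumes d: "distinct xs" and ord: "a < c" "c < b" and bc: "before ys b c" and ca: "before ys c a"
    and later: "(\<nexists>x. before ys c x \<and> before ys x a) \<or> overtop ys b c a"
  obtains D M where "before xs b D" "before xs D c" "before xs c M" "before xs M a" "M < D" "c < M"
    "before ys a D" "before ys a M" "overtop xs b c a"
proof -
  note iff = before_stack_sort_iff[OF d, folded ys_def]
  have dy: "distinct ys" and sy: "set ys = set xs"
    using d by (simp_all add: ys_def distinct_stack_sort set_stack_sort)
  define SD where "SD = {x. before xs b x \<and> before xs x c}"
  define SM where "SM = {x. before xs c x \<and> before xs x a}"
  have fin: "finite SD" "finite SM"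
    by (rule finite_subset[of _ "set xs"]; use before_in_set in \<open>force simp: SD_def SM_def\<close>)+
  obtain d0 where d0: "d0 \<in> SD" "b < d0" using iff[of c b] bc ord by (auto simp: SD_def)
  obtain m0 where m0: "m0 \<in> SM" "c < m0" using iff[of a c] ca ord by (auto simp: SM_def)
  define D where "D = Max SD"
  define M where "M = Max SM"
  have D: "before xs b D" "before xs D c" using Max_in[OF fin(1)] d0 by (auto simp: D_def SD_def)
  have M: "before xs c M" "before xs M a" using Max_in[OF fin(2)] m0 by (auto simp: M_def SM_def)
  have Dmax: "x \<le> D" if "before xs b x" "before xs x c" for x
    using that fin by (simp add: D_def SD_def)
  have Mmax: "x \<le> M" if "before xs c x" "before xs x a" for x
    using that fin by (simp add: M_def SM_def)
  have Db: "b < D" using d0 Dmax by (force simp: SD_def)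
  have Mc: "c < M" using m0 Mmax by (force simp: SM_def)
  have inset: "a \<in> set ys" "M \<in> set ys" "D \<in> set ys" "c \<in> set ys" "b \<in> set ys"
    using sy D M before_in_set by (metis)+
  have noMa: "\<not> before ys M a"
    using iff[of a M] Mc ord Mmax M(1) before_trans[OF _ _ d] by (meson leD less_trans)
  then have aM: "before ys a M" using before_total[OF inset(1,2)] Mc ord by auto
  have noDc: "\<not> before ys D c"
    using iff[of c D] Db ord Dmax D(1) before_trans[OF _ _ d] by (meson leD less_trans)
  then have cD: "before ys c D" using before_total[OF inset(4,3)] Db ord by auto
  have "M \<noteq> D" using M D before_asym[OF d] by metis
  moreover have "\<not> D < M"
  proof
    assume "D < M"
    then have "before ys D a"
      using iff[of a D] Db ord M D before_trans[OF _ _ d] by (meson less_trans)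
    \<comment> \<open>Now \<open>D\<close> lies between \<open>c\<close> and \<open>a\<close> in
      \<open>ys\<close>, which rules out the first alternative of \<open>later\<close>.\<close>
    with cD later obtain e where e: "before ys b e" "before ys e c" "D < e"
      unfolding overtop_def by blast
    have "c < e" "b < e" using e Db ord by auto
    then obtain z where z: "z > e" "before xs e z" "before xs z c" using iff[of c e] e by auto
    \<comment> \<open>Otherwise \<open>z\<close> would stand between \<open>e\<close> and
      \<open>b\<close> in \<open>xs\<close>, keeping \<open>e\<close> before \<open>b\<close> in
      \<open>ys\<close>.\<close>
    have "\<not> before xs z b"
      using iff[of b e] z(1,2) \<open>b < e\<close> before_asym[OF dy e(1)] by blast
    moreover have "z \<in> set xs" "b \<in> set xs" using z D before_in_set by metis+
    moreover have "z \<noteq> b" using z \<open>b < e\<close> by auto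
    ultimately have "before xs b z" using before_total by metis
    then have "z \<le> D" using Dmax z by blast
    then show False using z e by simp
  qed
  ultimately have MD: "M < D" by simp
  have ot: "overtop xs b c a"
    unfolding overtop_def using D MD Mmax le_less_trans by blast
  \<comment> \<open>A larger entry between \<open>D\<close> and \<open>a\<close> would lie on one
    side of \<open>c\<close>, contradicting the maximality of \<open>D\<close> or of
    \<open>M\<close>.\<close>
  have "\<not> before ys D a"
  proof
    assume "before ys D a"
    then obtain z where z: "z > D" "before xs D z" "before xs z a" using iff[of a D] Db ord by auto
    have "z \<noteq> c" using z Db ord by auto
    moreover have "z \<in> set xs" "c \<in> set xs" using z D before_in_set by metis+
    ultimately consider "before xs z c" | "before xs c z" using before_total by metis
    then show False
    proof cases
      case 1
      then show False using Dmax[of z] z D before_trans[OF _ _ d] by (meson leD)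
    next
      case 2
      then show False using Mmax[of z] z MD by simp
    qed
  qed
  then have "before ys a D" using before_total[OF inset(1,3)] Db ord by auto
  then show thesis using that[of D M] D M MD aM ot Mc by blast
qed

definition larger_after :: "nat list \<Rightarrow> nat \<Rightarrow> nat \<Rightarrow> nat set" where
  "larger_after xs c a = {x. c < x \<and> before xs a x}"

lemma finite_larger_after: "finite (larger_after xs c a)"
  by (rule finite_subset[of _ "set xs"]) (auto simp: larger_after_def dest: before_in_set)

text \<open>The second conjunct carries the final adjacency of \<open>c\<close> and \<open>a\<close>
  back to earlier iterates, where it supplies the hypothesis \<open>later\<close> of
  \<open>overtop_step\<close>.\<close>

lemma card_larger_after:
  assumes "distinct xs" "a < c" "c < b"
    and "before ((stack_sort ^^ k) xs) b c" "before ((stack_sort ^^ k) xs) c a"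
    and "\<nexists>x. before ((stack_sort ^^ k) xs) c x \<and> before ((stack_sort ^^ k) xs) x a"
  shows "card (larger_after xs c a) + 2 * k \<le> card (larger_after ((stack_sort ^^ k) xs) c a)
    \<and> ((\<nexists>x. before xs c x \<and> before xs x a) \<or> overtop xs b c a)"
  using assms(1,4-)
proof (induction k arbitrary: xs)
  case (Suc k)
  define ys where "ys = stack_sort xs"
  have eq: "(stack_sort ^^ Suc k) xs = (stack_sort ^^ k) ys"
    by (simp add: ys_def funpow_swap1)
  have dy: "distinct ys" using Suc.prems by (simp add: ys_def distinct_stack_sort)
  have IH: "card (larger_after ys c a) + 2 * k \<le> card (larger_after ((stack_sort ^^ k) ys) c a)"
    "(\<nexists>x. before ys c x \<and> before ys x a) \<or> overtop ys b c a"
    using Suc.IH[OF dy] Suc.prems unfolding eq by auto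
  have bca: "before ys b c" "before ys c a"
    using Suc.prems dy assms(2,3) before_stack_sort_funpowD unfolding eq by metis+
  obtain D M where DM: "before xs b D" "before xs D c" "before xs c M" "before xs M a" "M < D" "c < M"
    "before ys a D" "before ys a M" "overtop xs b c a"
    using overtop_step[OF Suc.prems(1) assms(2,3)] bca IH(2) unfolding ys_def by metis
  have Da: "before xs D a" using DM(2-4) before_trans Suc.prems(1) by metis
  \<comment> \<open>A pass creates no inversions, so a larger entry to the right of \<open>a\<close>
    stays there.\<close>
  have sub: "larger_after xs c a \<subseteq> larger_after ys c a"
  proof
    fix x assume "x \<in> larger_after xs c a"
    then have x: "c < x" "before xs a x" by (auto simp: larger_after_def)
    then have "\<not> before ys x a"
      using before_stack_sortD[OF Suc.prems(1)] before_asym[OF Suc.prems(1)] assms(2)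
      unfolding ys_def by (meson less_trans)
    moreover have "x \<in> set ys" "a \<in> set ys"
      using before_in_set[OF x(2)] Suc.prems(1) by (auto simp: ys_def set_stack_sort)
    ultimately show "x \<in> larger_after ys c a"
      using x before_total[of x ys a] assms(2) by (auto simp: larger_after_def)
  qed
  \<comment> \<open>Both \<open>D\<close> and \<open>M\<close> precede \<open>a\<close> in
    \<open>xs\<close> and follow it in \<open>ys\<close>, so they are two new members.\<close>
  have "card (larger_after xs c a) + 2 = card (insert D (insert M (larger_after xs c a)))"
    using DM Da before_asym[OF Suc.prems(1)] finite_larger_after[of xs c a]
    by (subst card_insert_disjoint; (subst card_insert_disjoint)?) (auto simp: larger_after_def)
  also have "\<dots> \<le> card (larger_after ys c a)"
    using DM sub by (intro card_mono finite_larger_after) (auto simp: larger_after_def)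
  finally show ?case using IH(1) DM(9) unfolding eq by simp
qed simp

text \<open>An inversion \<open>x y\<close> after \<open>a\<close> in the image needs some
  \<open>z > x\<close> between them beforehand. If \<open>z\<close> preceded \<open>a\<close>, then
  \<open>x\<close> would still precede \<open>a\<close> afterwards; so \<open>z\<close> follows
  \<open>a\<close>, and \<open>inc\<close> gives \<open>z < y\<close>, which is absurd.\<close>

lemma increasing_after_min_step:
  assumes d: "distinct xs" and min: "\<forall>x \<in> set xs. a \<le> x"
    and inc: "\<And>x y. before xs a x \<Longrightarrow> before xs x y \<Longrightarrow> x < y"
    and "before (stack_sort xs) a x" "before (stack_sort xs) x y"
  shows "x < y"
proof (rule ccontr)
  assume "\<not> x < y"
  have dy: "distinct (stack_sort xs)" using d by (rule distinct_stack_sort)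
  have in_xs: "a \<in> set xs" "x \<in> set xs" "y \<in> set xs"
    using before_in_set[OF assms(4)] before_in_set[OF assms(5)] d by (auto simp: set_stack_sort)
  have "x \<noteq> y" using assms(5) before_irrefl[OF dy] by metis
  then have yx: "y < x" using \<open>\<not> x < y\<close> by simp
  obtain z where z: "x < z" "before xs x z" "before xs z y"
    using before_stack_sort_iff[OF d yx] assms(5) by auto
  have ax: "a < x" using min in_xs yx by force
  have "before xs a z"
  proof (rule ccontr)
    assume "\<not> before xs a z"
    then have "before xs z a" using before_total[of a xs z] z in_xs ax before_in_set[OF z(2)] by auto
    then have "before (stack_sort xs) x a" using before_stack_sort_iff[OF d ax] z by blast
    then show False using before_asym[OF dy] assms(4) by blast
  qed
  then have "z < y" using inc z by blast
  then show False using z yx by simp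
qed

text \<open>With the minimum \<open>a\<close> in last position the claim is vacuous at the start,
  and each pass preserves it.\<close>

lemma increasing_after_min:
  assumes "distinct xs" "\<forall>x \<in> set xs. a \<le> x" "\<And>x. \<not> before xs a x"
    and "before ((stack_sort ^^ k) xs) a x" "before ((stack_sort ^^ k) xs) x y"
  shows "x < y"
  using assms(4,5)
proof (induction k arbitrary: x y)
  case (Suc k)
  show ?case
  proof (rule increasing_after_min_step)
    show "distinct ((stack_sort ^^ k) xs)" using assms(1) by (rule distinct_stack_sort_funpow)
    show "\<forall>x \<in> set ((stack_sort ^^ k) xs). a \<le> x" using assms by (simp add: set_stack_sort_funpow)
  qed (use Suc in auto)
qed (use assms in auto)

lemma stack_sort_funpow_descent:
  assumes p: "p \<in> Sn (2 * t + 3)" and "a < c" "c < b" "(stack_sort ^^ t) p = U @ c # a # V" "b \<in> set U"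
  shows "(stack_sort ^^ t) p = zeta b (t + 3) \<and> 3 \<le> b \<and> b \<le> t + 3"
proof -
  define n where "n = 2 * t + 3"
  define q where "q = (stack_sort ^^ t) p"
  have qU: "q = U @ c # a # V" using assms by (simp add: q_def)
  have dp: "distinct p" and sp: "set p = {1..n}" using p by (auto simp: permutations_of_set_def n_def)
  have dq: "distinct q" and sq: "set q = {1..n}"
    using dp sp by (simp_all add: q_def distinct_stack_sort_funpow set_stack_sort_funpow)
  have bc: "before q b c" and ca: "before q c a" using assms(5) by (auto simp: qU before_append)
  have adj: "\<nexists>x. before q c x \<and> before q x a"
  proof
    assume "\<exists>x. before q c x \<and> before q x a"
    then obtain x where x: "before q c x" "before q x a" by blast
    then show False using dq unfolding qU by (auto simp: before_append dest: before_in_set)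
  qed
  have 1: "card (larger_after p c a) + 2 * t \<le> card (larger_after q c a)"
    using card_larger_after[OF dp assms(2,3)] bc ca adj unfolding q_def by blast
  have sub: "larger_after q c a \<subseteq> {c + 1..n} - {b}"
  proof
    fix x assume "x \<in> larger_after q c a"
    then have x: "c < x" "before q a x" by (auto simp: larger_after_def)
    have "x \<noteq> b" using x bc ca before_trans before_asym dq by metis
    moreover have "x \<in> set q" using x before_in_set by metis
    ultimately show "x \<in> {c + 1..n} - {b}" using x sq by auto
  qed
  have bin: "b \<in> {c + 1..n}" using before_in_set[OF bc] sq assms by auto
  then have cardS: "card ({c + 1..n} - {b}) = n - c - 1" by simp
  have ub: "card (larger_after q c a) \<le> n - c - 1"
    using card_mono[OF _ sub] cardS by simp
  moreover have "c + 1 \<le> n" using bin by simp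
  \<comment> \<open>Since \<open>n = 2 * t + 3\<close>, this leaves only \<open>c\<close> \<le>
    \<open>2\<close>.\<close>
  ultimately have "2 * t + c + 1 \<le> n" using 1 by linarith
  moreover have "1 \<le> a" using before_in_set[OF ca] sq by auto
  ultimately have c: "c = 2" and a: "a = 1" using assms(2) by (auto simp: n_def)
  \<comment> \<open>With \<open>c = 2\<close> both bounds are attained: nothing above
    \<open>2\<close> follows \<open>1\<close> in \<open>p\<close>, and everything above
    \<open>2\<close> except \<open>b\<close> follows \<open>1\<close> in \<open>q\<close>.\<close>
  have card0: "card (larger_after p c a) = 0"
    and cardq: "card (larger_after q c a) = card ({c + 1..n} - {b})"
    using 1 ub cardS c by (auto simp: n_def)
  have empty: "larger_after p 2 1 = {}" using card0 finite_larger_after[of p c a] a c by simp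
  have full: "larger_after q 2 1 = {3..n} - {b}"
    using card_subset_eq[OF _ sub cardq] a c by simp
  have b1: "before p b c" "before p c a"
    using bc ca dp assms(2,3) before_stack_sort_funpowD unfolding q_def by metis+
  have last_1: "\<not> before p 1 x" for x
  proof
    assume x: "before p 1 x"
    then have "x \<noteq> 2" "x \<noteq> 1" using b1 before_asym[OF dp] before_irrefl[OF dp] a c by metis+
    moreover have "1 \<le> x" using before_in_set[OF x] sp by auto
    ultimately have "x \<in> larger_after p 2 1" using x by (simp add: larger_after_def)
    then show False using empty by simp
  qed
  \<comment> \<open>As \<open>1\<close> is last in \<open>p\<close>, the entries that have moved
    past it are in increasing order; this determines \<open>V\<close>.\<close>
  have inc: "x < y" if "before q 1 x" "before q x y" for x y
  proof (rule increasing_after_min[OF dp])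
    show "\<forall>x \<in> set p. 1 \<le> x" using sp by simp
    show "before ((stack_sort ^^ t) p) 1 x" "before ((stack_sort ^^ t) p) x y"
      using that by (simp_all only: q_def)
  qed (rule last_1)
  have setV: "set V = {3..n} - {b}"
  proof -
    have "before q 1 x \<longleftrightarrow> x \<in> set V" for x
      using dq unfolding qU a by (auto simp: before_append dest: before_in_set)
    moreover have "0 \<notin> set q" using sq by simp
    then have "2 \<notin> set V" "1 \<notin> set V" "0 \<notin> set V" using dq unfolding qU a c by auto
    ultimately have "larger_after q 2 1 = {x. 2 < x \<and> x \<in> set V}"
      by (simp add: larger_after_def)
    also have "\<dots> = set V"
    proof -
      have "2 < x" if "x \<in> set V" for x
        using that \<open>2 \<notin> set V\<close> \<open>1 \<notin> set V\<close> \<open>0 \<notin> set V\<close>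
        by (cases "x = 0 \<or> x = 1 \<or> x = 2") auto
      then show ?thesis by blast
    qed
    finally show ?thesis using full by simp
  qed
  have "sorted_wrt (<) V"
    using inc by (intro sorted_wrt_before) (auto simp: qU a before_append dest: before_in_set)
  moreover have "sorted_wrt (<) ([3..<b] @ [b + 1..<n + 1])"
    by (auto simp: sorted_wrt_append simp del: upt_Suc)
  moreover have "set ([3..<b] @ [b + 1..<n + 1]) = set V"
    using bin c by (auto simp: setV simp del: upt_Suc)
  ultimately have V: "V = [3..<b] @ [b + 1..<n + 1]"
    by (metis strict_sorted_iff sorted_distinct_set_unique)
  have "set U = {b}"
  proof -
    have "set U \<subseteq> {1..n}" using sq unfolding qU by auto
    moreover have "set U \<inter> ({3..n} - {b}) = {}" "1 \<notin> set U" "2 \<notin> set U"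
      using dq setV unfolding qU a c by auto
    moreover have "{1..n} \<subseteq> {1, 2} \<union> {3..n}" by auto
    ultimately have "set U \<subseteq> {b}" by blast
    then show ?thesis using assms(5) by auto
  qed
  moreover have "distinct U" using dq qU by simp
  ultimately have U: "U = [b]"
    by (metis distinct_card One_nat_def card.empty card.insert empty_iff empty_set finite.emptyI
        length_0_conv length_Suc_conv list.set_intros(1) singletonD)
  have z: "q = zeta b (t + 3)" using qU U V a c by (simp add: zeta_def n_def del: upt_Suc)
  \<comment> \<open>The last \<open>t\<close> positions of \<open>q\<close> hold the values above
    \<open>t + 3\<close>, whereas \<open>b\<close> stands first.\<close>
  have "b \<le> t + 3"
  proof (rule ccontr)
    assume "\<not> b \<le> t + 3"
    obtain r where r: "r \<in> Sn (n - t)" "q = r @ [n - t + 1..<n + 1]"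
      using stack_sort_funpow_tail[of p n t] p unfolding n_def q_def by auto
    have "b \<notin> set r" using r \<open>\<not> b \<le> t + 3\<close> by (auto simp: permutations_of_set_def n_def)
    moreover have "set r = {1..n - t}" using r by (simp add: permutations_of_set_def)
    then have "r \<noteq> []" by (auto simp: n_def)
    then have "hd q = hd r" "hd r \<in> set r" using r by auto
    moreover have "hd q = b" using z by (simp add: zeta_def)
    ultimately show False by simp
  qed
  then show ?thesis using z bin c by (simp add: q_def)
qed

subsection \<open>Descent tops\<close>

text \<open>As \<open>w\<close> increases and \<open>M\<close> exceeds all other entries, a descent
  either starts at \<open>M\<close> or lies inside \<open>q\<close>.\<close>

lemma good_descent:
  assumes "good p" "p = U @ c # a # V" "a < c" "x \<in> set U"
  shows "x < c"
  using assms
proof (induction arbitrary: V rule: good.induct)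
  case (block q w M)
  have w: "\<not> (\<exists>W. w = W @ c # a # V)"
    using block.hyps(2) block.prems(2) by (auto simp: sorted_wrt_append)
  from block.prems(1) consider
      (left) us where "q = U @ us" "us @ M # w = c # a # V"
    | (right) us where "U = q @ us" "M # w = us @ c # a # V"
    by (auto simp: append_eq_append_conv2)
  then show ?case
  proof cases
    case left
    show ?thesis
    proof (cases us)
      case Nil
      then have "c = M" using left by simp
      then show ?thesis using left Nil block.hyps block.prems by auto
    next
      case (Cons u us')
      then show ?thesis
      proof (cases us')
        case Nil
        then have "u = c" "M = a" using left Cons by auto
        then show ?thesis using block.hyps(4) left Cons block.prems(2) by auto
      next
        case (Cons u' us'')
        then have "q = U @ c # a # us''" using left \<open>us = u # us'\<close> by simp
        then show ?thesis using block.IH block.prems by blast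
      qed
    qed
  next
    case right
    then have "us = []" using w by (cases us) auto
    then show ?thesis using right block.hyps block.prems by auto
  qed
qed simp

text \<open>Split at the maximum \<open>m\<close>: the hypothesis passes to \<open>L\<close>, and a
  descent in \<open>R\<close> would have the larger entry \<open>m\<close> to its left, so
  \<open>R\<close> is increasing.\<close>

lemma good_if_no_321_descent:
  assumes "distinct p" "\<And>U c a V b. p = U @ c # a # V \<Longrightarrow> a < c \<Longrightarrow> b \<in> set U \<Longrightarrow> b < c"
  shows "good p"
  using assms
proof (induction p rule: distinct_max_induct)
  case (max L m R)
  have "good L"
  proof (rule max.IH(1))
    fix U c a V b assume "L = U @ c # a # V" "a < c" "b \<in> set U"
    then show "b < c" using max.prems[of U c a "V @ m # R" b] by simp
  qed
  moreover have "sorted_wrt (<) R"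
  proof (rule ccontr)
    assume "\<not> sorted_wrt (<) R"
    then have "\<not> sorted R" using max.hyps(1) by (simp add: strict_sorted_iff)
    then obtain i where i: "Suc i < length R" "R ! i > R ! Suc i"
      by (auto simp: sorted_iff_nth_Suc)
    have "R = take i R @ R ! i # R ! Suc i # drop (Suc (Suc i)) R"
      using i by (metis Cons_nth_drop_Suc Suc_lessD append_take_drop_id)
    then have "L @ m # R = (L @ m # take i R) @ R ! i # R ! Suc i # drop (Suc (Suc i)) R"
      by simp
    then have "m < R ! i" using max.prems[of "L @ m # take i R" "R ! i" "R ! Suc i"] i by simp
    moreover have "R ! i \<in> set R" using i by simp
    ultimately show False using max.hyps(2) by (meson UnI2 less_asym)
  qed
  ultimately show ?case using max.hyps by (intro good.block) auto
qed (simp add: good.Nil)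

lemma good_iff_descent_tops:
  assumes "distinct p"
  shows "good p \<longleftrightarrow> (\<forall>x. descent_top p x \<longrightarrow> lr_max p x)"
proof
  assume g: "good p"
  show "\<forall>x. descent_top p x \<longrightarrow> lr_max p x"
  proof (intro allI impI)
    fix x assume "descent_top p x"
    then obtain i where i: "Suc i < length p" "x = p ! i" "p ! i > p ! Suc i"
      by (auto simp: descent_top_def)
    have eq: "p = take i p @ p ! i # p ! Suc i # drop (Suc (Suc i)) p"
      using i by (metis Cons_nth_drop_Suc Suc_lessD append_take_drop_id)
    have "p ! k < p ! i" if "k < i" for k
    proof -
      have "p ! k \<in> set (take i p)" using that i by (auto simp: in_set_conv_nth)
      then show ?thesis using good_descent[OF g eq] i by blast
    qed
    then show "lr_max p x" unfolding lr_max_def using i by (intro exI[of _ i]) auto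
  qed
next
  assume lr: "\<forall>x. descent_top p x \<longrightarrow> lr_max p x"
  show "good p"
  proof (rule good_if_no_321_descent[OF assms])
    fix U c a V b assume p: "p = U @ c # a # V" "a < c" "b \<in> set U"
    have "descent_top p c"
      unfolding descent_top_def using p by (intro exI[of _ "length U"]) (auto simp: nth_append)
    then obtain j where j: "j < length p" "c = p ! j" "\<forall>k<j. p ! k < p ! j"
      using lr by (auto simp: lr_max_def)
    have "p ! length U = c" "length U < length p" using p by auto
    then have "j = length U" using j assms nth_eq_iff_index_eq by metis
    moreover obtain k where k: "k < length U" "U ! k = b" using p(3) by (auto simp: in_set_conv_nth)
    moreover have "p ! k = b" using k by (simp add: p(1) nth_append)
    ultimately show "b < c" using j(2,3) by metis
  qed
qed

section \<open>Realising \<open>zeta\<close> as an image\<close>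

text \<open>An explicit orbit ending in \<open>zeta\<close>: at each step the last entry of \<open>D\<close> and the last entry of
  \<open>M\<close> move into \<open>R\<close>, and the new last entry of \<open>M\<close> slips between \<open>2\<close> and \<open>1\<close>.\<close>
definition zeta_stage :: "nat \<Rightarrow> nat list \<Rightarrow> nat list \<Rightarrow> nat list \<Rightarrow> nat list" where
  "zeta_stage b D M R = b # (if M = [] then 2 # 1 # R
     else D @ butlast M @ 2 # last M # 1 # R)"

text \<open>The tail \<open>R2\<close> stays. Before it, \<open>d\<close> is the maximum and splits
  the list into the increasing \<open>b # D\<close> and \<open>M @ 2 # y # 1 # R1\<close>. In the
  latter \<open>R1\<close> stays, \<open>y\<close> passes \<open>1\<close>, and the last entry of
  \<open>M\<close> passes \<open>2\<close>.\<close>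

lemma stack_sort_zeta_stage:
  assumes len: "length D = length M"
    and sM: "sorted_wrt (<) (M @ y # R1)" and sD: "sorted_wrt (<) (D @ d # R2)"
    and lt: "\<forall>x \<in> set (M @ y # R1). \<forall>z \<in> set (D @ d # R2). x < z"
    and ge: "\<forall>x \<in> set (M @ y # R1). 2 < x \<and> x \<noteq> b"
    and b: "2 < b" "\<forall>z \<in> set (D @ d # R2). b < z"
  shows "stack_sort (zeta_stage b (D @ [d]) (M @ [y]) (R1 @ R2)) = zeta_stage b D M (y # R1 @ d # R2)"
proof -
  let ?T = "M @ 2 # y # [1]"
  have M: "sorted_wrt (<) M" "sorted_wrt (<) R1" "\<And>x. x \<in> set M \<Longrightarrow> x < y"
      "\<And>x z. x \<in> set M \<Longrightarrow> z \<in> set R1 \<Longrightarrow> x < z" "\<And>z. z \<in> set R1 \<Longrightarrow> y < z"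
    using sM by (auto simp: sorted_wrt_append)
  have D: "sorted_wrt (<) D" "sorted_wrt (<) R2" "\<And>x. x \<in> set D \<Longrightarrow> x < d"
      "\<And>z. z \<in> set R2 \<Longrightarrow> d < z" "\<And>z. z \<in> set D \<Longrightarrow> b < z" "b < d"
    using sD b by (auto simp: sorted_wrt_append)
  have two: "\<And>x. x \<in> set M \<Longrightarrow> 2 < x \<and> x \<noteq> b" "\<And>x. x \<in> set R1 \<Longrightarrow> 2 < x \<and> x \<noteq> b" "2 < y" "y \<noteq> b"
    using ge by auto
  have dT: "distinct (?T @ R1)"
  proof -
    have "2 \<notin> set M" "1 \<notin> set M" using two(1)[of 2] two(1)[of 1] by auto
    moreover have "2 \<notin> set R1" "1 \<notin> set R1" using two(2)[of 2] two(2)[of 1] by auto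
    moreover have "y \<notin> set M" "y \<notin> set R1" using M(3)[of y] M(5)[of y] by auto
    moreover have "set M \<inter> set R1 = {}" using M(4) by blast
    moreover have "distinct M" "distinct R1" using M(1,2) by (simp_all add: strict_sorted_iff)
    ultimately show ?thesis using two(3) by auto
  qed
  have ltd: "x < d" if "x \<in> set (?T @ R1)" for x
    using that lt b(1) D(6) by auto
  have "z \<notin> set (?T @ R1)" if "z \<in> set D" for z
  proof -
    have "\<forall>x \<in> set (M @ y # R1). x < z" using that lt by simp
    then show ?thesis using D(5)[OF that] b(1) by auto
  qed
  moreover have "b \<notin> set (?T @ R1)" using two b(1) by auto
  moreover have "d \<notin> set (?T @ R1)" using ltd by blast
  moreover have "d \<notin> set D" "b \<notin> set D" using D(3)[of d] D(5)[of b] by auto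
  moreover have "distinct D" using D(1) by (simp add: strict_sorted_iff)
  ultimately have dL: "distinct ((b # D) @ d # ?T @ R1)"
    using dT D(6) unfolding distinct_append by auto
  have mL: "\<forall>x \<in> set (b # D) \<union> set (?T @ R1). x < d"
    using ltd D by auto
  have "stack_sort (((b # D) @ d # ?T @ R1) @ R2) = stack_sort ((b # D) @ d # ?T @ R1) @ R2"
  proof (rule stack_sort_append_increasing[OF dL])
    show "sorted_wrt (<) R2" by (rule D(2))
    show "\<forall>x \<in> set ((b # D) @ d # ?T @ R1). \<forall>z \<in> set R2. x < z"
    proof (intro ballI)
      fix x z assume x: "x \<in> set ((b # D) @ d # ?T @ R1)" and "z \<in> set R2"
      then have "d < z" using D(4) by blast
      moreover have "x \<le> d" using x mL by (cases "x = d") (auto simp: less_imp_le)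
      ultimately show "x < z" by simp
    qed
  qed
  also have "stack_sort ((b # D) @ d # ?T @ R1) = stack_sort (b # D) @ stack_sort (?T @ R1) @ [d]"
    using dL mL by (rule stack_sort_LmR)
  also have "stack_sort (b # D) = b # D"
    using D by (intro stack_sort_increasing) simp
  also have "stack_sort (?T @ R1) = stack_sort ?T @ R1"
  proof (rule stack_sort_append_increasing)
    show "distinct ?T" using dT by simp
    show "sorted_wrt (<) R1" by (rule M(2))
    show "\<forall>x \<in> set ?T. \<forall>z \<in> set R1. x < z"
      using M(4,5) two(2) by force
  qed
  also have "stack_sort ?T = stack_sort (M @ [2]) @ stack_sort [1] @ [y]"
  proof -
    have "\<forall>x \<in> set (M @ [2]) \<union> set [1]. x < y" using M(3) two(3) by auto
    moreover have "distinct ((M @ [2]) @ y # [1])" using dT by simp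
    ultimately show ?thesis using stack_sort_LmR[of "M @ [2]" y "[1]"] by simp
  qed
  also have "stack_sort [1] = [1]" by (simp add: stack_sort_increasing)
  finally have main: "stack_sort (zeta_stage b (D @ [d]) (M @ [y]) (R1 @ R2)) =
      b # D @ stack_sort (M @ [2]) @ 1 # y # R1 @ d # R2"
    by (simp add: zeta_stage_def)
  show ?thesis
  proof (cases M rule: rev_cases)
    case Nil
    then show ?thesis using main len by (simp add: zeta_stage_def stack_sort_increasing)
  next
    case (snoc M' x)
    have "stack_sort (M' @ x # [2]) = stack_sort M' @ stack_sort [2] @ [x]"
    proof (rule stack_sort_LmR)
      show "distinct (M' @ x # [2])" using dT snoc by auto
      show "\<forall>z \<in> set M' \<union> set [2]. z < x" using M(1) two(1) snoc by (auto simp: sorted_wrt_append)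
    qed
    also have "stack_sort [2] = [2]" by (simp add: stack_sort_increasing)
    also have "stack_sort M' = M'"
      using M(1) snoc by (intro stack_sort_increasing) (auto simp: sorted_wrt_append)
    finally show ?thesis using main snoc by (simp add: zeta_stage_def)
  qed
qed

text \<open>The right part is kept as \<open>R1 @ R2\<close> for the induction: each pass prepends
  an entry of \<open>M\<close> to \<open>R1\<close> and one of \<open>D\<close> to
  \<open>R2\<close>.\<close>

lemma stack_sort_funpow_zeta_stage:
  assumes "length D = length M"
    and "sorted_wrt (<) (M @ R1)" "sorted_wrt (<) (D @ R2)"
    and "\<forall>x \<in> set (M @ R1). \<forall>z \<in> set (D @ R2). x < z"
    and "\<forall>x \<in> set (M @ R1). 2 < x \<and> x \<noteq> b"
    and "2 < b" "\<forall>z \<in> set (D @ R2). b < z"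
  shows "(stack_sort ^^ length M) (zeta_stage b D M (R1 @ R2)) = b # 2 # 1 # M @ R1 @ D @ R2"
  using assms
proof (induction M arbitrary: D R1 R2 rule: rev_induct)
  case Nil
  then show ?case by (simp add: zeta_stage_def)
next
  case (snoc y M)
  obtain D' d where D: "D = D' @ [d]" using snoc.prems(1) by (cases D rule: rev_cases) auto
  have step: "stack_sort (zeta_stage b (D' @ [d]) (M @ [y]) (R1 @ R2)) = zeta_stage b D' M ((y # R1) @ d # R2)"
    using stack_sort_zeta_stage[of D' M y R1 d R2 b] snoc.prems by (simp add: D)
  have "(stack_sort ^^ length (M @ [y])) (zeta_stage b D (M @ [y]) (R1 @ R2)) =
      (stack_sort ^^ length M) (zeta_stage b D' M ((y # R1) @ d # R2))"
    unfolding D step[symmetric] by (simp add: funpow_swap1)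
  also have "\<dots> = b # 2 # 1 # M @ (y # R1) @ D' @ d # R2"
    using snoc.prems by (intro snoc.IH) (simp_all add: D)
  finally show ?case by (simp add: D)
qed

lemma zeta_in_image:
  assumes "3 \<le> b" "b \<le> t + 3"
  shows "zeta b (t + 3) \<in> (stack_sort ^^ t) ` Sn (2 * t + 3)"
proof -
  \<comment> \<open>Besides \<open>b\<close>, \<open>2\<close> and \<open>1\<close>, the values
    split into the \<open>t\<close> smaller ones \<open>M\<close> and the \<open>t\<close> larger
    ones \<open>D\<close>; \<open>b\<close> \<le> \<open>t + 3\<close> puts all of \<open>D\<close>
    above \<open>b\<close>.\<close>
  define M where "M = [3..<b] @ [b + 1..<t + 4]"
  define D where "D = [t + 4..<2 * t + 4]"
  have len: "length D = length M" "length M = t" using assms by (auto simp: M_def D_def)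
  have sM: "sorted_wrt (<) M" by (auto simp: M_def sorted_wrt_append simp del: upt_Suc)
  have sD: "sorted_wrt (<) D" by (simp add: D_def del: upt_Suc)
  have setM: "set M = {3..t + 3} - {b}" using assms by (auto simp: M_def simp del: upt_Suc)
  have setD: "set D = {t + 4..2 * t + 3}" by (auto simp: D_def simp del: upt_Suc)
  have "(stack_sort ^^ length M) (zeta_stage b D M ([] @ [])) = b # 2 # 1 # M @ [] @ D @ []"
  proof (rule stack_sort_funpow_zeta_stage)
    show "sorted_wrt (<) (M @ [])" "sorted_wrt (<) (D @ [])" using sM sD by simp_all
  qed (use len assms in \<open>auto simp: setM setD\<close>)
  moreover have "b # 2 # 1 # M @ D = zeta b (t + 3)"
  proof -
    have "[b + 1..<t + 4] @ [t + 4..<t + 4 + t] = [b + 1..<t + 4 + t]"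
      using assms by (intro upt_add_eq_append[symmetric]) simp
    moreover have "t + 4 + t = 2 * t + 4" "2 * (t + 3) - 2 = 2 * t + 4" by simp_all
    ultimately have "[b + 1..<t + 4] @ [t + 4..<2 * t + 4] = [b + 1..<2 * (t + 3) - 2]" by metis
    then show ?thesis by (simp only: zeta_def M_def D_def append_assoc)
  qed
  ultimately have eq: "(stack_sort ^^ t) (zeta_stage b D M []) = zeta b (t + 3)" using len by simp
  have mset: "mset (zeta_stage b D M []) = mset (b # 2 # 1 # M @ D)"
  proof (cases M rule: rev_cases)
    case Nil
    then show ?thesis using len by (simp add: zeta_stage_def)
  qed (simp add: zeta_stage_def)
  have "distinct (b # 2 # 1 # M @ D)"
    using assms sM sD by (auto simp: setM setD strict_sorted_iff)
  moreover have "set (b # 2 # 1 # M @ D) = {1..2 * t + 3}"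
    using assms by (auto simp: setM setD)
  ultimately have "zeta_stage b D M [] \<in> Sn (2 * t + 3)"
    using mset_eq_setD[OF mset] mset_eq_imp_distinct_iff[OF mset]
    unfolding permutations_of_set_def by blast
  then show ?thesis using eq by (metis imageI)
qed

subsection \<open>Set partitions\<close>

text \<open>Arbitrary value sets are allowed because removing the last block can leave any subset
  that avoids the maximum.\<close>

definition good_perms :: "nat set \<Rightarrow> nat list set" where
  "good_perms A = {p \<in> permutations_of_set A. good p}"

lemma finite_good_perms: "finite A \<Longrightarrow> finite (good_perms A)"
  by (simp add: good_perms_def)

text \<open>The last block starts with the maximum \<open>M\<close>; its other entries form an
  arbitrary set \<open>W\<close> in forced order, and the rest is an arbitrary \<open>good\<close>
  permutation.\<close>

lemma bij_betw_good_perms: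
  assumes "finite A" "A \<noteq> {}"
  defines "M \<equiv> Max A"
  shows "bij_betw (\<lambda>(W, q). q @ M # sorted_list_of_set W)
    (SIGMA W:Pow (A - {M}). good_perms (A - {M} - W)) (good_perms A)"
proof -
  have MA: "M \<in> A" "\<And>x. x \<in> A \<Longrightarrow> x \<le> M" using assms by auto
  have "inj_on (\<lambda>(W, q). q @ M # sorted_list_of_set W)
      (SIGMA W:Pow (A - {M}). good_perms (A - {M} - W))"
  proof (rule inj_onI, clarify)
    fix W q W' q'
    assume *: "W \<subseteq> A - {M}" "q \<in> good_perms (A - {M} - W)"
      "W' \<subseteq> A - {M}" "q' \<in> good_perms (A - {M} - W')"
      "q @ M # sorted_list_of_set W = q' @ M # sorted_list_of_set W'"
    have "M \<notin> set q" "M \<notin> set q'" using * by (auto simp: good_perms_def permutations_of_set_def)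
    moreover have fin: "finite W" "finite W'" using * assms(1) finite_subset by blast+
    then have "M \<notin> set (sorted_list_of_set W)" "M \<notin> set (sorted_list_of_set W')"
      using * by auto
    ultimately have "q = q'" "sorted_list_of_set W = sorted_list_of_set W'"
      using *(5) by (auto simp: append_Cons_eq_iff)
    then show "W = W' \<and> q = q'" using fin sorted_list_of_set_inject by blast
  qed
  moreover have "(\<lambda>(W, q). q @ M # sorted_list_of_set W) `
      (SIGMA W:Pow (A - {M}). good_perms (A - {M} - W)) = good_perms A"
  proof (intro equalityI subsetI)
    fix p assume "p \<in> (\<lambda>(W, q). q @ M # sorted_list_of_set W) `
      (SIGMA W:Pow (A - {M}). good_perms (A - {M} - W))"
    then obtain W q where W: "W \<subseteq> A - {M}" "q \<in> good_perms (A - {M} - W)"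
      "p = q @ M # sorted_list_of_set W" by auto
    have fW: "finite W" using W assms(1) finite_subset by blast
    have q: "set q = A - {M} - W" "good q" using W by (auto simp: good_perms_def permutations_of_set_def)
    have g: "good p" unfolding W(3)
    proof (rule good.block[OF q(2)])
      show "\<forall>x \<in> set q \<union> set (sorted_list_of_set W). x < M"
        using q fW W(1) MA by (auto simp: order_less_le)
    qed (use q fW in auto)
    moreover have "set p = A" using q fW W MA by auto
    ultimately show "p \<in> good_perms A"
      using good_distinct by (simp add: good_perms_def permutations_of_set_def)
  next
    fix p assume "p \<in> good_perms A"
    then have p: "good p" "set p = A" "distinct p" by (auto simp: good_perms_def permutations_of_set_def)
    from p(1) show "p \<in> (\<lambda>(W, q). q @ M # sorted_list_of_set W) `
      (SIGMA W:Pow (A - {M}). good_perms (A - {M} - W))"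
    proof cases
      case Nil
      then show ?thesis using p assms(2) by simp
    next
      case (block q w N)
      have "N = M" using p block MA unfolding M_def
        by (intro Max_eqI[symmetric]) (auto simp: assms(1) order_less_imp_le)
      moreover have "q \<in> good_perms (A - {M} - set w)"
        using p block \<open>N = M\<close> by (auto simp: good_perms_def permutations_of_set_def)
      moreover have "w = sorted_list_of_set (set w)"
        using block(3) by (metis strict_sorted_iff sorted_list_of_set.idem_if_sorted_distinct)
      moreover have "set w \<subseteq> A - {M}" using p block \<open>N = M\<close> by auto
      ultimately show ?thesis using block(1) by (intro image_eqI[of _ _ "(set w, q)"]) auto
    qed
  qed
  ultimately show ?thesis by (simp add: bij_betw_def)
qed

text \<open>Here \<open>insert M W\<close> is the part containing \<open>M\<close>. The index set of
  the \<open>W\<close> is the same as for \<open>good_perms\<close>, so both counts obey one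
  recurrence.\<close>

lemma bij_betw_partition_on:
  assumes "M \<in> A"
  shows "bij_betw (\<lambda>(W, P). insert (insert M W) P)
    (SIGMA W:Pow (A - {M}). {P. partition_on (A - {M} - W) P}) {P. partition_on A P}"
proof -
  have "inj_on (\<lambda>(W, P). insert (insert M W) P)
    (SIGMA W:Pow (A - {M}). {P. partition_on (A - {M} - W) P})"
  proof (rule inj_onI, clarify)
    fix W P W' P'
    assume *: "W \<subseteq> A - {M}" "partition_on (A - {M} - W) P"
      "W' \<subseteq> A - {M}" "partition_on (A - {M} - W') P'"
      "insert (insert M W) P = insert (insert M W') P'"
    have noM: "B \<in> P \<Longrightarrow> M \<notin> B" "B \<in> P' \<Longrightarrow> M \<notin> B" for B
      using *(2,4) by (auto simp: partition_on_def)
    have "insert M W = insert M W'" using *(5) noM by (metis insertCI insertE)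
    moreover have "M \<notin> W" "M \<notin> W'" using * by auto
    ultimately have "W = W'" by (metis insert_ident)
    moreover have "P = P'" using *(5) noM \<open>W = W'\<close> by (metis insertI1 insert_ident)
    ultimately show "W = W' \<and> P = P'" by simp
  qed
  moreover have "(\<lambda>(W, P). insert (insert M W) P) `
    (SIGMA W:Pow (A - {M}). {P. partition_on (A - {M} - W) P}) = {P. partition_on A P}"
  proof (intro equalityI subsetI)
    fix Q assume "Q \<in> (\<lambda>(W, P). insert (insert M W) P) `
      (SIGMA W:Pow (A - {M}). {P. partition_on (A - {M} - W) P})"
    then obtain W P where W: "W \<subseteq> A - {M}" "partition_on (A - {M} - W) P"
      "Q = insert (insert M W) P" by auto
    have "disjnt (insert M W) (\<Union>P)" using W(2) by (auto simp: partition_on_def disjnt_iff)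
    moreover have "A - insert M W = A - {M} - W" by auto
    ultimately have "partition_on A Q" using W assms by (auto simp: partition_on_insert)
    then show "Q \<in> {P. partition_on A P}" by simp
  next
    fix Q assume "Q \<in> {P. partition_on A P}"
    then have Q: "partition_on A Q" by simp
    then obtain B where B: "B \<in> Q" "M \<in> B" using assms by (auto simp: partition_on_def)
    have "disjnt B (\<Union> (Q - {B}))" using Q B by (auto simp: partition_on_def disjoint_def disjnt_def)
    then have "partition_on (A - B) (Q - {B})"
      using Q B partition_on_insert[of B "Q - {B}" A] by (simp add: insert_absorb)
    moreover have "A - {M} - (B - {M}) = A - B" using B by auto
    moreover have "B - {M} \<subseteq> A - {M}" using B Q by (auto simp: partition_on_def)
    moreover have "insert M (B - {M}) = B" using B by auto
    ultimately show "Q \<in> (\<lambda>(W, P). insert (insert M W) P) `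
      (SIGMA W:Pow (A - {M}). {P. partition_on (A - {M} - W) P})"
      using B by (intro image_eqI[of _ _ "(B - {M}, Q - {B})"]) auto
  qed
  ultimately show ?thesis by (simp add: bij_betw_def)
qed

lemma card_good_perms:
  assumes "finite A"
  shows "card (good_perms A) = card {P. partition_on A P}"
  using assms
proof (induction "card A" arbitrary: A rule: less_induct)
  case less
  show ?case
  proof (cases "A = {}")
    case True
    have "{P. partition_on ({} :: nat set) P} = {{}}" by (auto simp: partition_on_empty)
    then show ?thesis using True by (simp add: good_perms_def good.Nil cong: conj_cong)
  next
    case False
    define M where "M = Max A"
    have M: "M \<in> A" using less.prems False by (simp add: M_def)
    have fin: "finite (Pow (A - {M}))" using less.prems by simp
    have IH: "card (good_perms (A - {M} - W)) = card {P. partition_on (A - {M} - W) P}" for W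
      using less.prems M by (intro less.hyps psubset_card_mono) auto
    have "card (good_perms A) = card (SIGMA W:Pow (A - {M}). good_perms (A - {M} - W))"
      using bij_betw_same_card[OF bij_betw_good_perms[OF less.prems False]] by (simp add: M_def)
    also have "\<dots> = (\<Sum>W \<in> Pow (A - {M}). card (good_perms (A - {M} - W)))"
      using fin less.prems by (intro card_SigmaI) (auto intro: finite_good_perms)
    also have "\<dots> = (\<Sum>W \<in> Pow (A - {M}). card {P. partition_on (A - {M} - W) P})"
      by (simp only: IH)
    also have "\<dots> = card (SIGMA W:Pow (A - {M}). {P. partition_on (A - {M} - W) P})"
      using fin less.prems by (intro card_SigmaI[symmetric]) (auto intro: finitely_many_partition_on)
    also have "\<dots> = card {P. partition_on A P}"
      using bij_betw_same_card[OF bij_betw_partition_on[OF M]] .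
    finally show ?thesis .
  qed
qed

section \<open>Determining the image and its size\<close>

text \<open>The last \<open>t\<close> entries of an image are fixed. If the prefix \<open>q\<close>
  is not \<open>good\<close>, it has a descent with a larger entry to its left, which forces a
  \<open>zeta\<close>.\<close>

lemma stack_sort_image_eq:
  "(stack_sort ^^ t) ` Sn (2 * t + 3) =
    (\<lambda>q. q @ [t + 4..<2 * t + 4]) ` good_perms {1..t + 3} \<union> (\<lambda>l. zeta l (t + 3)) ` {3..t + 3}"
proof (intro equalityI subsetI)
  fix p assume "p \<in> (stack_sort ^^ t) ` Sn (2 * t + 3)"
  then obtain r where r: "r \<in> Sn (2 * t + 3)" "p = (stack_sort ^^ t) r" by blast
  obtain q where q: "q \<in> Sn (t + 3)" "p = q @ [t + 4..<2 * t + 4]"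
    using stack_sort_funpow_tail[OF r(1), of t] r(2) by (auto simp: algebra_simps simp del: upt_Suc)
  show "p \<in> (\<lambda>q. q @ [t + 4..<2 * t + 4]) ` good_perms {1..t + 3} \<union> (\<lambda>l. zeta l (t + 3)) ` {3..t + 3}"
  proof (cases "good q")
    case True
    then show ?thesis using q by (auto simp: good_perms_def simp del: upt_Suc)
  next
    case False
    moreover have "distinct q" using q by (simp add: permutations_of_set_def)
    ultimately obtain U c a V b where "q = U @ c # a # V" "a < c" "b \<in> set U" "\<not> b < c"
      using good_if_no_321_descent by blast
    moreover from this have "b \<noteq> c" using \<open>distinct q\<close> by auto
    ultimately have "p = zeta b (t + 3) \<and> 3 \<le> b \<and> b \<le> t + 3"
      using stack_sort_funpow_descent[OF r(1), of a c b U "V @ [t + 4..<2 * t + 4]"] r(2) q(2) by simp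
    then show ?thesis by auto
  qed
next
  fix p assume "p \<in> (\<lambda>q. q @ [t + 4..<2 * t + 4]) ` good_perms {1..t + 3} \<union> (\<lambda>l. zeta l (t + 3)) ` {3..t + 3}"
  then show "p \<in> (stack_sort ^^ t) ` Sn (2 * t + 3)"
  proof
    assume "p \<in> (\<lambda>q. q @ [t + 4..<2 * t + 4]) ` good_perms {1..t + 3}"
    then obtain q where q: "q \<in> Sn (t + 3)" "good q" "p = q @ [t + 4..<2 * t + 4]"
      by (auto simp: good_perms_def)
    have "t + 3 + 1 = t + 4" "t + 3 + t + 1 = 2 * t + 4" "t + 3 + t = 2 * t + 3" by simp_all
    then show ?thesis using good_tail_in_image[OF q(2,1), of t] q(3) by metis
  next
    assume "p \<in> (\<lambda>l. zeta l (t + 3)) ` {3..t + 3}"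
    then show ?thesis using zeta_in_image by fastforce
  qed
qed

text \<open>The larger entry \<open>l\<close> stands to the left of the descent \<open>2 1\<close>.
  This makes the two families of images disjoint.\<close>

lemma zeta_not_good: "\<not> good (zeta l m)" if "3 \<le> l"
proof
  assume "good (zeta l m)"
  then have "l < 2"
    by (rule good_descent[where U = "[l]" and a = 1 and V = "[3..<l] @ [l + 1..<2 * m - 2]"])
      (auto simp: zeta_def)
  then show False using that by simp
qed

theorem theorem1p2:
  fixes m :: nat
  assumes "m \<ge> 3"
  shows "(\<forall>p \<in> Sn (2 * m - 3).
            p \<in> (stack_sort ^^ (m - 3)) ` Sn (2 * m - 3) \<longleftrightarrow>
              (tail_length p \<ge> m - 3 \<and> (\<forall>x. descent_top p x \<longrightarrow> lr_max p x)) \<or>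
              (\<exists>l \<in> {3..m}. p = zeta l m))
         \<and> card ((stack_sort ^^ (m - 3)) ` Sn (2 * m - 3)) = bell m + m - 2"
proof -
  define t where "t = m - 3"
  have m: "m = t + 3" and n: "2 * m - 3 = 2 * t + 3" using assms by (auto simp: t_def)
  define G where "G = (\<lambda>q. q @ [t + 4..<2 * t + 4]) ` good_perms {1..t + 3}"
  define Z where "Z = (\<lambda>l. zeta l (t + 3)) ` {3..t + 3}"
  have image: "(stack_sort ^^ t) ` Sn (2 * t + 3) = G \<union> Z"
    unfolding G_def Z_def by (rule stack_sort_image_eq)
  have good_ext: "good (q @ [t + 4..<2 * t + 4])" if "q \<in> good_perms {1..t + 3}" for q
    using that by (intro good_append_increasing)
      (auto simp: good_perms_def permutations_of_set_def simp del: upt_Suc)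
  have G_iff: "p \<in> G \<longleftrightarrow> t \<le> tail_length p \<and> good p" if p: "p \<in> Sn (2 * t + 3)" for p
  proof
    assume "p \<in> G"
    then obtain q where q: "q \<in> good_perms {1..t + 3}" "p = q @ [t + 4..<2 * t + 4]"
      by (auto simp: G_def)
    have "\<exists>q \<in> Sn (2 * t + 3 - t). p = q @ [2 * t + 3 - t + 1..<2 * t + 3 + 1]"
      using q by (intro bexI[of _ q]) (auto simp: good_perms_def algebra_simps simp del: upt_Suc)
    then show "t \<le> tail_length p \<and> good p"
      using tail_length_ge_iff[OF p, of t] good_ext q by simp
  next
    assume *: "t \<le> tail_length p \<and> good p"
    then obtain q where q: "q \<in> Sn (t + 3)" "p = q @ [t + 4..<2 * t + 4]"
      using tail_length_ge_iff[OF p, of t] by (auto simp: algebra_simps simp del: upt_Suc)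
    \<comment> \<open>A descent of the prefix \<open>q\<close> is also a descent of
      \<open>p\<close>, with the same entries to its left.\<close>
    have "good q"
    proof (rule good_if_no_321_descent)
      show "distinct q" using q by (simp add: permutations_of_set_def)
      fix U c a V b assume "q = U @ c # a # V" "a < c" "b \<in> set U"
      then show "b < c"
        using good_descent[of p U c a "V @ [t + 4..<2 * t + 4]" b] * q(2) by simp
    qed
    then show "p \<in> G" using q by (auto simp: G_def good_perms_def)
  qed
  have "\<forall>p \<in> Sn (2 * t + 3). p \<in> (stack_sort ^^ t) ` Sn (2 * t + 3) \<longleftrightarrow>
      (t \<le> tail_length p \<and> (\<forall>x. descent_top p x \<longrightarrow> lr_max p x)) \<or> (\<exists>l \<in> {3..m}. p = zeta l m)"
  proof
    fix p assume p: "p \<in> Sn (2 * t + 3)"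
    then have "good p \<longleftrightarrow> (\<forall>x. descent_top p x \<longrightarrow> lr_max p x)"
      by (intro good_iff_descent_tops) (simp add: permutations_of_set_def)
    moreover have "p \<in> Z \<longleftrightarrow> (\<exists>l \<in> {3..m}. p = zeta l m)" by (auto simp: Z_def m)
    ultimately show "p \<in> (stack_sort ^^ t) ` Sn (2 * t + 3) \<longleftrightarrow>
      (t \<le> tail_length p \<and> (\<forall>x. descent_top p x \<longrightarrow> lr_max p x)) \<or> (\<exists>l \<in> {3..m}. p = zeta l m)"
      using G_iff[OF p] unfolding image by blast
  qed
  moreover have "card (G \<union> Z) = bell m + m - 2"
  proof -
    have fin: "finite G" "finite Z" by (auto simp: G_def Z_def intro: finite_good_perms)
    have "good p" if "p \<in> G" for p using that good_ext by (auto simp: G_def)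
    moreover have "\<not> good p" if "p \<in> Z" for p using that by (auto simp: Z_def zeta_not_good)
    ultimately have disj: "G \<inter> Z = {}" by blast
    have "card G = bell m"
      unfolding G_def bell_def m by (subst card_image) (auto simp: inj_on_def card_good_perms)
    \<comment> \<open>The first entry of \<open>zeta l m\<close> is \<open>l\<close>, so the values
      \<open>l = 3, ..., m\<close> give distinct permutations.\<close>
    moreover have "card Z = m - 2"
      unfolding Z_def m by (subst card_image) (auto simp: inj_on_def zeta_def)
    ultimately show ?thesis using card_Un_disjoint[OF fin disj] assms by simp
  qed
  ultimately show ?thesis unfolding n t_def[symmetric] by (simp only: image)
qed

end
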